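(* For all complex $x$ with $|x|\le 1$ (where for $x=\pm1$ the right-hand side is understood as its limit as $x\to\pm1$), $$\begin{aligned}\sum_{n=0}^{\infty}\left(H_n^- - \log 2\right)^2 \frac{x^{n+1}}{n+1} ={}& \int_0^x \frac{\operatorname{Li}_2(t)}{1-t}\,dt + \log(1-x)\left[2\operatorname{Li}_2\left(\tfrac{1+x}{2}\right) - \tfrac{\pi^2}{6}\right] \\ &+ 2\log(1+x)\left(\log^2(1-x) - \log^2 2\right) + 2\log 2\left[\operatorname{Li}_2\left(\tfrac{1+x}{2}\right) - \operatorname{Li}_2\left(\tfrac{1}{2}\right)\right] \\ &- 2\log 2\,\log^2(1-x) + 4\log(1-x)\operatorname{Li}_2\left(\tfrac{1-x}{2}\right) - 4\left[\operatorname{Li}_3\left(\tfrac{1-x}{2}\right) - \operatorname{Li}_3\left(\tfrac{1}{2}\right)\right].\end{aligned}$$ In particular, for $x=\pm1$, $$\sum_{n=0}^{\infty}\left(H_n^- - \log 2\right)^2 \frac{1}{n+1} = \frac{3}{2}\zeta(3) - \frac{\pi^2}{6}\log 2 - \frac{1}{3}\log^3 2,$$ $$\sum_{n=0}^{\infty}\left(H_n^- - \log 2\right)^2 \frac{(-1)^{n+1}}{n+1} = \frac{\pi^2}{12}\log 2 - \frac{3}{4}\zeta(3) - \frac{1}{3}\log^3 2.$$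
   Context: The skew-harmonic numbers are $H_0^-=0$ and $H_n^- =\sum_{k=1}^n \frac{(-1)^{k-1}}{k}$ for $n\ge 1$. $\operatorname{Li}_m(t)=\sum_{n=1}^\infty \frac{t^n}{n^m}$ for $|t|\le 1$, $m=2,3$. $\log$ is the principal branch of the natural logarithm, $\log^k a=(\log a)^k$, $\zeta$ is the Riemann zeta function, and $\int_0^x$ is taken along the straight segment from $0$ to $x$. *)

theory Defs
  imports "HOL-Complex_Analysis.Complex_Analysis"
begin

definition skew_harm :: "nat \<Rightarrow> real" where
  "skew_harm n = (\<Sum>k=1..n. (-1) ^ (k - 1) / real k)"

text \<open>The series is indexed from \<open>n = 0\<close>; it converges on the closed unit disc for \<open>m \<ge> 2\<close>,
  and its value elsewhere is not meaningful.\<close>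

definition Li :: "nat \<Rightarrow> complex \<Rightarrow> complex" where
  "Li m t = (\<Sum>n. t ^ Suc n / of_nat (Suc n) ^ m)"

text \<open>The Riemann zeta function on the half-plane \<open>Re s > 1\<close>, where it is given by its
  Dirichlet series; the analytic continuation is not needed.\<close>

definition zeta :: "complex \<Rightarrow> complex" where
  "zeta s = (\<Sum>n. 1 / of_nat (Suc n) powr s)"

definition skew_harm_term :: "complex \<Rightarrow> nat \<Rightarrow> complex" where
  "skew_harm_term x n = (of_real (skew_harm n) - ln 2)\<^sup>2 * (x ^ (n + 1) / of_nat (n + 1))"

text \<open>Here \<open>ln\<close> on complex numbers is the principal branch. Since \<open>ln 0 = 0\<close> by convention,
  the value at \<open>x = 1\<close> and \<open>x = -1\<close> is not meaningful; only the limit there is.\<close>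

definition skew_harm_rhs :: "complex \<Rightarrow> complex" where
  "skew_harm_rhs x =
     contour_integral (linepath 0 x) (\<lambda>t. Li 2 t / (1 - t))
     + ln (1 - x) * (2 * Li 2 ((1 + x) / 2) - of_real pi ^ 2 / 6)
     + 2 * ln (1 + x) * (ln (1 - x) ^ 2 - ln 2 ^ 2)
     + 2 * ln 2 * (Li 2 ((1 + x) / 2) - Li 2 (1 / 2))
     - 2 * ln 2 * ln (1 - x) ^ 2
     + 4 * ln (1 - x) * Li 2 ((1 - x) / 2)
     - 4 * (Li 3 ((1 - x) / 2) - Li 3 (1 / 2))"

end

theory Submission
  imports Defs "HOL-Real_Asymp.Real_Asymp"
begin

text \<open>
  Write \<open>a\<^sub>n\<close> for the remainder \<open>H\<^sub>n\<^sup>- - log 2\<close>. The alternating series test gives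
  \<open>\<bar>a\<^sub>n\<bar> \<le> 1 / (n + 1)\<close>, so the series \<open>S(x) = \<Sum> a\<^sub>n\<^sup>2 x\<^sup>n\<^sup>+\<^sup>1 / (n + 1)\<close> converges uniformly on the closed
  disc and \<open>S\<close> is continuous there.

  Inside the disc, \<open>S'(x) = \<Sum> a\<^sub>n\<^sup>2 x\<^sup>n\<close> has a closed form. Multiplying a power series by \<open>1 - x\<close>
  replaces its coefficients by their differences. Since \<open>a\<^sub>n\<^sub>+\<^sub>1 - a\<^sub>n = (-1)\<^sup>n / (n + 1)\<close>, this gives
  \<open>(1 - y) \<Sum> a\<^sub>n y\<^sup>n = log (1 + y) - log 2\<close>; since
  \<open>a\<^sub>n\<^sub>+\<^sub>1\<^sup>2 - a\<^sub>n\<^sup>2 = 2 (-1)\<^sup>n a\<^sub>n / (n + 1) + 1 / (n + 1)\<^sup>2\<close>, integrating the former identity at \<open>y = - x\<close>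
  yields \<open>(1 - x) S'(x) = Li\<^sub>2(x) - 2 Li\<^sub>2((1 + x) / 2) + \<pi>\<^sup>2 / 6\<close>
  (\<open>skew_harm_tail_square_power_series\<close>). The terms of the claimed formula other than the integral
  have derivative \<open>S'(x) - Li\<^sub>2(x) / (1 - x)\<close>. Hence \<open>S\<close> minus these terms is a primitive of the
  integrand along the open segment from \<open>0\<close> to \<open>x\<close>, is continuous up to its end, and vanishes
  at \<open>0\<close>; the fundamental theorem of calculus gives the formula on the whole closed disc
  without \<open>\<plusminus>1\<close> (\<open>skew_harm_rhs_eq\<close>). At \<open>\<plusminus>1\<close> the limit of the right-hand side exists and
  equals \<open>S(\<plusminus>1)\<close> because \<open>S\<close> is continuous.

  For the values \<open>S(\<plusminus>1)\<close> it is easier to integrate \<open>S'\<close> on the real axis once more than to pass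
  to the limit in the formula, whose terms diverge. Euler's reflection formula shows that
  \<open>\<Phi>(u) = ln u Li\<^sub>2(u) - 2 Li\<^sub>3(u)\<close> has derivative \<open>(Li\<^sub>2(1 - u) - \<pi>\<^sup>2 / 6) / u\<close>. Up to additive
  constants, therefore,
  \<open>S(x) = 2 \<Phi>((1 - x) / 2) - \<Phi>(1 - x)\<close> for \<open>0 < x < 1\<close>; for \<open>-1 < x < 0\<close>, where \<open>1 - x\<close> is
  larger than 1, Landen's formula gives instead
  \<open>S(x) = 2 \<Phi>((1 - x) / 2) - \<Phi>(1 / (1 - x)) + (\<pi>\<^sup>2 / 3) ln (1 - x) + ln\<^sup>3 (1 - x) / 6\<close>.
  Comparing both ends of each interval leaves only \<open>\<Phi>(0) = 0\<close>,
  \<open>\<Phi>(1) = - 2 \<zeta>(3)\<close> and \<open>\<Phi>(1/2)\<close>, that is, the classical values of \<open>Li\<^sub>2(1/2)\<close> and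
  \<open>Li\<^sub>3(1/2)\<close>.
\<close>

section \<open>Power series integrated termwise\<close>

lemma summable_bounded_power_series:
  fixes c :: "nat \<Rightarrow> 'a::{real_normed_field,banach}"
  assumes "\<And>n. norm (c n) \<le> K" "norm x < 1"
  shows "summable (\<lambda>n. c n * x ^ n)"
proof (rule summable_comparison_test')
  show "summable (\<lambda>n. K * norm x ^ n)"
    using assms(2) by (intro summable_mult summable_geometric) simp
  show "norm (c n * x ^ n) \<le> K * norm x ^ n" for n
    using assms(1)[of n] by (simp add: norm_mult norm_power mult_right_mono)
qed

text \<open>The polylogarithms of positive order, the series of the theorem and the auxiliary
  series of its proof all have this shape. Keeping the factor \<open>1 / (n + 1)\<close> outside \<open>c\<close> makes the
  derivative the power series of \<open>c\<close> itself, for which boundedness of \<open>c\<close> suffices.\<close>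

definition primitive_series :: "(nat \<Rightarrow> 'a::{real_normed_field,banach}) \<Rightarrow> 'a \<Rightarrow> 'a" where
  "primitive_series c x = (\<Sum>n. c n * x ^ Suc n / of_nat (Suc n))"

lemma primitive_series_0 [simp]: "primitive_series c 0 = 0"
  by (simp add: primitive_series_def)

lemma has_field_derivative_primitive_series:
  fixes c :: "nat \<Rightarrow> 'a::{real_normed_field,banach}"
  assumes c: "\<And>n. norm (c n) \<le> K" and x: "norm x < 1"
  shows "(primitive_series c has_field_derivative (\<Sum>n. c n * x ^ n)) (at x)"
proof -
  \<comment> \<open>the coefficients of the primitive as an ordinary power series, with constant term 0\<close>
  define d where "d n = (case n of 0 \<Rightarrow> 0 | Suc k \<Rightarrow> c k / of_nat (Suc k))" for n
  have "norm (d n) \<le> K" for n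
  proof (cases n)
    case 0
    then show ?thesis using order_trans[OF norm_ge_zero c] by (simp add: d_def)
  next
    case (Suc k)
    have "norm (c k) / real (Suc k) \<le> norm (c k) / 1"
      by (intro divide_left_mono) auto
    with c[of k] have "norm (c k) / real (Suc k) \<le> K"
      by linarith
    then show ?thesis
      by (simp only: d_def Suc norm_divide norm_of_nat nat.case)
  qed
  then have summ: "summable (\<lambda>n. d n * z ^ n)" if "norm z < 1" for z
    using summable_bounded_power_series that by blast
  have eq: "(\<Sum>n. d n * z ^ n) = primitive_series c z" if "norm z < 1" for z
    using suminf_split_head[OF summ[OF that]] by (simp add: d_def primitive_series_def)
  have "diffs d = c"
    by (auto simp: diffs_def d_def fun_eq_iff simp del: of_nat_Suc)
  then have "((\<lambda>z. \<Sum>n. d n * z ^ n) has_field_derivative (\<Sum>n. c n * x ^ n)) (at x)"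
    using termdiffs_strong'[OF summ x] by simp
  then show ?thesis
    by (rule has_field_derivative_transform_within_open[where S = "ball 0 1"]) (use x eq in auto)
qed

lemma sums_primitive_series:
  fixes c :: "nat \<Rightarrow> 'a::{real_normed_field,banach}"
  assumes "summable (\<lambda>n. norm (c n) / real (Suc n))" "norm x \<le> 1"
  shows "(\<lambda>n. c n * x ^ Suc n / of_nat (Suc n)) sums primitive_series c x"
  unfolding primitive_series_def
proof (rule summable_sums, rule summable_comparison_test'[OF assms(1)])
  fix n
  have "norm (c n) * norm x ^ Suc n \<le> norm (c n) * 1"
    using assms(2) by (intro mult_left_mono power_le_one) auto
  then show "norm (c n * x ^ Suc n / of_nat (Suc n)) \<le> norm (c n) / real (Suc n)"
    unfolding norm_mult norm_power norm_divide norm_of_nat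
    by (intro divide_right_mono) auto
qed

lemma continuous_on_primitive_series:
  fixes c :: "nat \<Rightarrow> 'a::{real_normed_field,banach}"
  assumes "summable (\<lambda>n. norm (c n) / real (Suc n))"
  shows "continuous_on (cball 0 1) (primitive_series c)"
proof -
  have "uniform_limit (cball 0 1) (\<lambda>N x. \<Sum>n<N. c n * x ^ Suc n / of_nat (Suc n))
          (\<lambda>x. \<Sum>n. c n * x ^ Suc n / of_nat (Suc n)) sequentially"
  proof (rule Weierstrass_m_test[OF _ assms])
    fix n and x :: 'a
    assume "x \<in> cball 0 1"
    then have "norm (c n) * norm x ^ Suc n \<le> norm (c n) * 1"
      by (intro mult_left_mono power_le_one) auto
    then show "norm (c n * x ^ Suc n / of_nat (Suc n)) \<le> norm (c n) / real (Suc n)"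
      unfolding norm_mult norm_power norm_divide norm_of_nat
      by (intro divide_right_mono) auto
  qed
  moreover have "\<forall>\<^sub>F N in sequentially. continuous_on (cball 0 1)
      (\<lambda>x. \<Sum>n<N. c n * x ^ Suc n / of_nat (Suc n))"
    by (intro always_eventually allI continuous_intros) (simp del: of_nat_Suc)
  ultimately show ?thesis
    unfolding primitive_series_def [abs_def]
    by (intro uniform_limit_theorem) auto
qed

text \<open>Summation by parts. It reduces the generating functions of the remainders of a series and
  of their squares to simpler ones, because the differences of these coefficients are simpler.\<close>

lemma one_minus_times_power_series:
  fixes c :: "nat \<Rightarrow> 'a::{real_normed_field,banach}"
  assumes "\<And>n. norm (c n) \<le> K" "norm x < 1"
  shows "(1 - x) * (\<Sum>n. c n * x ^ n) = c 0 + (\<Sum>n. (c (Suc n) - c n) * x ^ Suc n)"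
proof -
  have s: "summable (\<lambda>n. c n * x ^ n)"
    using summable_bounded_power_series[OF assms] .
  have s1: "summable (\<lambda>n. c (Suc n) * x ^ Suc n)"
    using s by (subst summable_Suc_iff)
  have s2: "summable (\<lambda>n. c n * x ^ Suc n)"
    using summable_mult[OF s, of x] by (simp add: mult_ac)
  have "(\<Sum>n. (c (Suc n) - c n) * x ^ Suc n)
      = (\<Sum>n. c (Suc n) * x ^ Suc n) - (\<Sum>n. c n * x ^ Suc n)"
    using suminf_diff[OF s1 s2] by (simp only: left_diff_distrib)
  also have "(\<Sum>n. c n * x ^ Suc n) = x * (\<Sum>n. c n * x ^ n)"
    using suminf_mult[OF s, of x] by (simp add: mult_ac)
  also have "(\<Sum>n. c (Suc n) * x ^ Suc n) = (\<Sum>n. c n * x ^ n) - c 0"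
    using suminf_split_head[OF s] by simp
  finally show ?thesis
    by (simp add: algebra_simps)
qed

section \<open>Polylogarithms\<close>

text \<open>Generic in the field, so that the real special values can be found by real calculus and
  then transferred to the complex function.\<close>

definition polylog :: "nat \<Rightarrow> 'a::{real_normed_field,banach} \<Rightarrow> 'a" where
  "polylog m x = (\<Sum>n. x ^ Suc n / of_nat (Suc n) ^ m)"

lemma Li_eq_polylog: "Li = polylog"
  by (simp add: fun_eq_iff Li_def polylog_def)

lemma polylog_0 [simp]: "polylog m 0 = 0"
  by (simp add: polylog_def)

lemma polylog_Suc: "polylog (Suc m) = primitive_series (\<lambda>n. 1 / of_nat (Suc n) ^ m)"
  by (simp add: fun_eq_iff polylog_def primitive_series_def mult_ac del: of_nat_Suc)

lemma norm_inverse_power_le_1: "norm (1 / of_nat (Suc n) ^ m :: 'a::real_normed_field) \<le> 1"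
proof -
  have "1 \<le> real (Suc n) ^ m"
    by (rule one_le_power) simp
  then show ?thesis
    by (simp add: norm_divide norm_power del: of_nat_Suc)
qed

lemma summable_norm_polylog_coeffs:
  assumes "2 \<le> m"
  shows "summable (\<lambda>n. norm (1 / of_nat (Suc n) ^ (m - 1) :: 'a::real_normed_field) / real (Suc n))"
proof -
  obtain k where k: "m = Suc k" using assms by (cases m) auto
  have "summable (\<lambda>n. inverse (real (Suc n) ^ m))"
    using inverse_power_summable[OF assms, where ?'a = real] by (subst summable_Suc_iff)
  then show ?thesis
    by (simp add: k norm_divide norm_power field_simps del: of_nat_Suc)
qed

lemma sums_polylog:
  fixes x :: "'a::{real_normed_field,banach}"
  assumes "2 \<le> m" "norm x \<le> 1"
  shows "(\<lambda>n. x ^ Suc n / of_nat (Suc n) ^ m) sums polylog m x"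
proof -
  obtain k where k: "m = Suc k" using assms by (cases m) auto
  show ?thesis
    using sums_primitive_series[OF summable_norm_polylog_coeffs[OF assms(1)] assms(2)]
    by (simp add: k polylog_Suc mult_ac del: of_nat_Suc)
qed

lemma continuous_on_polylog:
  assumes "2 \<le> m"
  shows "continuous_on (cball 0 1) (polylog m :: 'a::{real_normed_field,banach} \<Rightarrow> 'a)"
proof -
  obtain k where k: "m = Suc k" using assms by (cases m) auto
  show ?thesis
    using continuous_on_primitive_series[OF summable_norm_polylog_coeffs[OF assms], where ?'a = 'a]
    by (simp add: k polylog_Suc del: of_nat_Suc)
qed

lemma continuous_on_polylog_compose [continuous_intros]:
  assumes "2 \<le> m" "continuous_on S f" "\<And>x. x \<in> S \<Longrightarrow> norm (f x) \<le> 1"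
  shows "continuous_on S (\<lambda>x. polylog m (f x))"
  using continuous_on_compose2[OF continuous_on_polylog[OF assms(1)] assms(2)] assms(3)
  by (simp add: image_subset_iff)

lemma has_field_derivative_polylog:
  fixes x :: "'a::{real_normed_field,banach}"
  assumes "norm x < 1" "x \<noteq> 0"
  shows "(polylog (Suc m) has_field_derivative polylog m x / x) (at x)"
proof -
  have "(polylog (Suc m) has_field_derivative (\<Sum>n. 1 / of_nat (Suc n) ^ m * x ^ n)) (at x)"
    unfolding polylog_Suc
    by (rule has_field_derivative_primitive_series[OF norm_inverse_power_le_1 assms(1)])
  moreover have "polylog m x = x * (\<Sum>n. 1 / of_nat (Suc n) ^ m * x ^ n)"
    using suminf_mult[OF summable_bounded_power_series
        [OF norm_inverse_power_le_1[of _ m] assms(1)], of x]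
    by (simp add: polylog_def mult_ac del: of_nat_Suc)
  ultimately show ?thesis
    using assms(2) by simp
qed

lemma polylog_1_complex:
  fixes x :: complex
  assumes "norm x < 1"
  shows "polylog 1 x = - ln (1 - x)"
proof -
  have "(\<lambda>n. - (x ^ n / of_nat n)) sums ln (1 - x)"
    using Ln_series'[of "- x"] assms by simp
  then have "(\<lambda>n. x ^ n / of_nat n) sums - ln (1 - x)"
    using sums_minus by fastforce
  then have "(\<lambda>n. x ^ Suc n / of_nat (Suc n)) sums - ln (1 - x)"
    by (subst sums_Suc_iff) simp
  then show ?thesis
    by (simp add: polylog_def sums_iff)
qed

lemma polylog_of_real:
  fixes x :: real
  assumes "2 \<le> m" "\<bar>x\<bar> \<le> 1"
  shows "polylog m (of_real x :: complex) = of_real (polylog m x)"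
proof -
  have "(\<lambda>n. of_real (x ^ Suc n / of_nat (Suc n) ^ m) :: complex) sums of_real (polylog m x)"
    using sums_polylog[OF assms(1), of x] assms(2) by (subst sums_of_real_iff) simp
  moreover have "(\<lambda>n. (of_real x :: complex) ^ Suc n / of_nat (Suc n) ^ m) sums polylog m (of_real x)"
    using sums_polylog[OF assms(1), of "of_real x :: complex"] assms(2) by simp
  ultimately show ?thesis
    by (simp add: sums_unique2 del: of_nat_Suc)
qed

lemma polylog_1_real:
  fixes x :: real
  assumes "\<bar>x\<bar> < 1"
  shows "polylog 1 x = - ln (1 - x)"
proof -
  have "(\<lambda>n. - (x ^ n / of_nat n)) sums ln (1 - x)"
    using ln_series'[of "- x"] assms by simp
  then have "(\<lambda>n. x ^ n / of_nat n) sums - ln (1 - x)"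
    using sums_minus by fastforce
  then have "(\<lambda>n. x ^ Suc n / of_nat (Suc n)) sums - ln (1 - x)"
    by (subst sums_Suc_iff) simp
  then show ?thesis
    by (simp add: polylog_def sums_iff)
qed

lemma dilog_has_real_derivative [derivative_intros]:
  fixes f :: "real \<Rightarrow> real"
  assumes "(f has_field_derivative D) (at x within S)" "norm (f x) < 1" "f x \<noteq> 0"
  shows "((\<lambda>x. polylog 2 (f x)) has_field_derivative - ln (1 - f x) / f x * D) (at x within S)"
  using DERIV_chain'[OF assms(1) has_field_derivative_polylog[OF assms(2,3), of 1]]
    polylog_1_real[of "f x"] assms(2,3)
  by (simp add: numeral_2_eq_2)

lemma trilog_has_real_derivative [derivative_intros]:
  fixes f :: "real \<Rightarrow> real"
  assumes "(f has_field_derivative D) (at x within S)" "norm (f x) < 1" "f x \<noteq> 0"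
  shows "((\<lambda>x. polylog 3 (f x)) has_field_derivative polylog 2 (f x) / f x * D) (at x within S)"
  using DERIV_chain'[OF assms(1) has_field_derivative_polylog[OF assms(2,3), of 2]]
    assms(2,3)
  by (simp add: numeral_eq_Suc)

lemma dilog_has_complex_derivative [derivative_intros]:
  fixes f :: "complex \<Rightarrow> complex"
  assumes "(f has_field_derivative D) (at x within S)" "norm (f x) < 1" "f x \<noteq> 0"
  shows "((\<lambda>x. polylog 2 (f x)) has_field_derivative - ln (1 - f x) / f x * D) (at x within S)"
  using DERIV_chain'[OF assms(1) has_field_derivative_polylog[OF assms(2,3), of 1]]
    polylog_1_complex[of "f x"] assms(2,3)
  by (simp add: numeral_2_eq_2)

lemma trilog_has_complex_derivative [derivative_intros]:
  fixes f :: "complex \<Rightarrow> complex"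
  assumes "(f has_field_derivative D) (at x within S)" "norm (f x) < 1" "f x \<noteq> 0"
  shows "((\<lambda>x. polylog 3 (f x)) has_field_derivative polylog 2 (f x) / f x * D) (at x within S)"
  using DERIV_chain'[OF assms(1) has_field_derivative_polylog[OF assms(2,3), of 2]]
    assms(2,3)
  by (simp add: numeral_eq_Suc)

section \<open>Special values of the real dilogarithm and trilogarithm\<close>

text \<open>Functional equations are proved by differentiation on an open interval; the constant of
  integration is read off at an endpoint, where logarithms blow up and only limits make
  sense.\<close>

lemma vanishing_derivative_limits_eq:
  fixes f :: "real \<Rightarrow> real"
  assumes "a < b"
    and deriv: "\<And>x. a < x \<Longrightarrow> x < b \<Longrightarrow> (f has_real_derivative 0) (at x)"
    and p: "(f \<longlongrightarrow> p) (at_right a)" and q: "(f \<longlongrightarrow> q) (at_left b)"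
  shows "p = q"
proof -
  define m where "m = (a + b) / 2"
  have m: "m \<in> {a<..<b}"
    using \<open>a < b\<close> by (simp add: m_def field_simps)
  have const: "f x = f m" if "x \<in> {a<..<b}" for x
    by (rule DERIV_isconst3[OF \<open>a < b\<close> that m]) (use deriv in auto)
  have "\<forall>\<^sub>F x in at_right a. f x = f m" "\<forall>\<^sub>F x in at_left b. f x = f m"
    using eventually_at_right_real[OF \<open>a < b\<close>] eventually_at_left_real[OF \<open>a < b\<close>]
    by (auto elim!: eventually_mono intro: const)
  then have "(f \<longlongrightarrow> f m) (at_right a)" "(f \<longlongrightarrow> f m) (at_left b)"
    by (auto intro: tendsto_eventually)
  with p q have "p = f m" "q = f m"
    by (meson tendsto_unique trivial_limit_at_right_real trivial_limit_at_left_real)+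
  then show ?thesis by simp
qed

lemma polylog_tendsto_0:
  assumes "2 \<le> m" "(f \<longlongrightarrow> 0) F"
  shows "((\<lambda>x. polylog m (f x :: real)) \<longlongrightarrow> 0) F"
proof -
  have "isCont (polylog m) (0::real)"
    using continuous_on_polylog[OF assms(1), where ?'a = real]
    by (rule continuous_on_interior) simp
  from isCont_tendsto_compose[OF this assms(2)] show ?thesis by simp
qed

lemma polylog_at_left_1: "2 \<le> m \<Longrightarrow> (polylog m \<longlongrightarrow> polylog m (1::real)) (at_left 1)"
proof -
  assume "2 \<le> m"
  then have "continuous_on {0..1::real} (polylog m)"
    by (intro continuous_on_subset[OF continuous_on_polylog]) (auto simp: cball_def)
  then show ?thesis
    by (rule continuous_on_Icc_at_leftD) simp
qed

lemma polylog_at_right_minus_1: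
  "2 \<le> m \<Longrightarrow> (polylog m \<longlongrightarrow> polylog m (-1::real)) (at_right (-1))"
proof -
  assume "2 \<le> m"
  then have "continuous_on {-1..0::real} (polylog m)"
    by (intro continuous_on_subset[OF continuous_on_polylog]) (auto simp: cball_def)
  then show ?thesis
    by (rule continuous_on_Icc_at_rightD) simp
qed

lemma isCont_polylog:
  assumes "2 \<le> m" "\<bar>x\<bar> < (1::real)"
  shows "isCont (polylog m) x"
  using continuous_on_polylog[OF assms(1), where ?'a = real]
  by (rule continuous_on_interior) (use assms(2) in simp)

lemma dilog_1: "polylog 2 (1::real) = pi\<^sup>2 / 6"
proof (rule sums_unique2)
  show "(\<lambda>n. 1 ^ Suc n / real (Suc n) ^ 2) sums polylog 2 1"
    by (rule sums_polylog) auto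
  show "(\<lambda>n. 1 ^ Suc n / real (Suc n) ^ 2) sums (pi\<^sup>2 / 6)"
    using inverse_squares_sums by (simp add: add_ac)
qed

text \<open>Euler's reflection formula. Both sides have the same derivative; as the argument tends
  to 1 the product of the logarithms tends to 0, which leaves the Basel sum.\<close>

lemma dilog_reflection:
  fixes x :: real
  assumes "0 < x" "x < 1"
  shows "polylog 2 x + polylog 2 (1 - x) = pi\<^sup>2 / 6 - ln x * ln (1 - x)"
proof -
  define f where "f y = polylog 2 y + polylog 2 (1 - y) + ln y * ln (1 - y)" for y :: real
  have deriv: "(f has_real_derivative 0) (at y)" if "0 < y" "y < 1" for y
  proof -
    have *: "norm y < 1" "y \<noteq> 0" "norm (1 - y) < 1" "1 - y \<noteq> 0" "0 < y" "0 < 1 - y"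
      using that by auto
    show ?thesis
      unfolding f_def
      by (rule derivative_eq_intros refl * numeral_neq_zero)+ (use that in \<open>simp add: field_simps\<close>)
  qed
  have "f x = pi\<^sup>2 / 6"
  proof (rule vanishing_derivative_limits_eq[OF assms(2), of f])
    show "(f has_real_derivative 0) (at y)" if "x < y" "y < 1" for y
      using deriv that assms by simp
    have "isCont f x"
      using deriv[OF assms] by (rule DERIV_isCont)
    then show "(f \<longlongrightarrow> f x) (at_right x)"
      by (simp add: isCont_def filterlim_at_split)
    have "((\<lambda>y::real. 1 - y) \<longlongrightarrow> 0) (at_left 1)" "((\<lambda>y::real. ln y * ln (1 - y)) \<longlongrightarrow> 0) (at_left 1)"
      by real_asymp+
    then have "(f \<longlongrightarrow> polylog 2 1 + 0 + 0) (at_left 1)"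
      unfolding f_def by (intro tendsto_add polylog_at_left_1 polylog_tendsto_0) auto
    then show "(f \<longlongrightarrow> pi\<^sup>2 / 6) (at_left 1)"
      by (simp add: dilog_1)
  qed
  then show ?thesis
    by (simp add: f_def algebra_simps)
qed

lemma dilog_half: "polylog 2 (1 / 2 :: real) = pi\<^sup>2 / 12 - (ln 2)\<^sup>2 / 2"
  using dilog_reflection[of "1 / 2"] by (simp add: ln_div power2_eq_square)

text \<open>Landen's formula. The hypothesis \<open>1/2 < x\<close> keeps \<open>1 - 1 / x\<close> inside
  \<open>(-1, 0)\<close>, where the power series converges. All terms vanish at \<open>x = 1\<close>.\<close>

lemma dilog_landen:
  fixes x :: real
  assumes "1 / 2 < x" "x < 1"
  shows "polylog 2 (1 - 1 / x) + polylog 2 (1 - x) = - (ln x)\<^sup>2 / 2"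
proof -
  define f where "f y = polylog 2 (1 - 1 / y) + polylog 2 (1 - y) + (ln y)\<^sup>2 / 2" for y :: real
  have deriv: "(f has_real_derivative 0) (at y)" if "1 / 2 < y" "y < 1" for y
  proof -
    have *: "norm (1 - 1 / y) < 1" "1 - 1 / y \<noteq> 0" "norm (1 - y) < 1" "1 - y \<noteq> 0"
        "0 < y" "y \<noteq> 0"
      using that by (auto simp: field_simps abs_if)
    have e1: "ln (1 - (1 - 1 / y)) = - ln y"
      using that by (simp add: ln_div)
    have e2: "1 - 1 / y = - (1 - y) / y"
      using that by (simp add: field_simps)
    show ?thesis
      unfolding f_def
      apply (rule derivative_eq_intros refl * numeral_neq_zero)+
      unfolding e1 unfolding e2
      using * apply (simp add: divide_simps)
      apply (simp add: algebra_simps power2_eq_square)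
      done
  qed
  have "f x = 0"
  proof (rule vanishing_derivative_limits_eq[OF assms(2), of f])
    show "(f has_real_derivative 0) (at y)" if "x < y" "y < 1" for y
      using deriv that assms by simp
    have "isCont f x"
      using deriv[OF assms] by (rule DERIV_isCont)
    then show "(f \<longlongrightarrow> f x) (at_right x)"
      by (simp add: isCont_def filterlim_at_split)
    have "((\<lambda>y::real. 1 - 1 / y) \<longlongrightarrow> 0) (at_left 1)" "((\<lambda>y::real. 1 - y) \<longlongrightarrow> 0) (at_left 1)"
         "((\<lambda>y::real. (ln y)\<^sup>2 / 2) \<longlongrightarrow> 0) (at_left 1)"
      by real_asymp+
    then have "(f \<longlongrightarrow> 0 + 0 + 0) (at_left 1)"
      unfolding f_def by (intro tendsto_add polylog_tendsto_0) auto
    then show "(f \<longlongrightarrow> 0) (at_left 1)"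
      by simp
  qed
  then show ?thesis
    by (simp add: f_def)
qed

text \<open>The average of \<open>Li\<^sub>3(1)\<close> and \<open>Li\<^sub>3(-1)\<close> keeps the terms with even denominators, and these
  sum to \<open>Li\<^sub>3(1) / 8\<close>.\<close>

lemma trilog_minus_1: "polylog 3 (- 1 :: real) = - 3 / 4 * polylog 3 1"
proof -
  \<comment> \<open>the index \<open>n\<close> carries the denominator \<open>n + 1\<close>, so even denominators sit at odd indices\<close>
  define g :: "nat \<Rightarrow> nat" where "g n = 2 * n + 1" for n
  define f where "f n = (1 + (-1) ^ Suc n) / real (Suc n) ^ 3" for n
  have 1: "(\<lambda>n. 1 ^ Suc n / real (Suc n) ^ 3) sums polylog 3 1"
    by (rule sums_polylog) auto
  have "(\<lambda>n. (-1) ^ Suc n / real (Suc n) ^ 3) sums polylog 3 (-1)"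
    by (rule sums_polylog) auto
  from sums_add[OF 1 this] have a: "f sums (polylog 3 1 + polylog 3 (-1))"
    by (simp add: f_def [abs_def] add_divide_distrib diff_divide_distrib del: of_nat_Suc)
  have "(\<lambda>n. f (g n)) sums (1 / 4 * polylog 3 1)"
  proof -
    have "f (g n) = 1 / 4 * (1 ^ Suc n / real (Suc n) ^ 3)" for n
    proof -
      have "real (Suc (g n)) = 2 * real (Suc n)"
        by (simp add: g_def)
      then show ?thesis
        by (simp add: f_def g_def power_mult_distrib del: of_nat_Suc)
    qed
    then show ?thesis
      using sums_mult[OF 1, of "1 / 4"] by (simp only:)
  qed
  moreover have "strict_mono g"
    by (auto simp: g_def strict_mono_def)
  moreover have "f n = 0" if "n \<notin> range g" for n
  proof -
    have "even n"
      using that by (metis g_def oddE rangeI)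
    then show ?thesis
      by (simp add: f_def)
  qed
  ultimately have "f sums (1 / 4 * polylog 3 1)"
    using sums_mono_reindex by blast
  from sums_unique2[OF a this] show ?thesis
    by simp
qed

text \<open>From Landen's three-term relation between \<open>Li\<^sub>3(y)\<close>, \<open>Li\<^sub>3(1 - y)\<close> and \<open>Li\<^sub>3(1 - 1 / y)\<close>,
  obtained by integrating the two dilogarithm identities. At \<open>y = 1/2\<close> the first two arguments
  coincide and the third is \<open>-1\<close>; at \<open>y = 1\<close> only \<open>Li\<^sub>3(1)\<close> survives.\<close>

lemma trilog_half:
  "polylog 3 (1 / 2 :: real) = 7 / 8 * polylog 3 1 - pi\<^sup>2 / 12 * ln 2 + (ln 2) ^ 3 / 6"
proof -
  define f where "f y = polylog 3 y + polylog 3 (1 - y) + polylog 3 (1 - 1 / y)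
    - (ln y) ^ 3 / 6 - pi\<^sup>2 / 6 * ln y + (ln y)\<^sup>2 * ln (1 - y) / 2" for y :: real
  have deriv: "(f has_real_derivative 0) (at y)" if "1 / 2 < y" "y < 1" for y
  proof -
    have l: "polylog 2 (1 - 1 / y) = - (ln y)\<^sup>2 / 2 - polylog 2 (1 - y)"
      using dilog_landen[OF that] by simp
    have r: "polylog 2 y = pi\<^sup>2 / 6 - ln y * ln (1 - y) - polylog 2 (1 - y)"
      using dilog_reflection[of y] that by simp
    have *: "norm (1 - 1 / y) < 1" "1 - 1 / y \<noteq> 0" "norm (1 - y) < 1" "1 - y \<noteq> 0"
        "norm y < 1" "0 < y" "0 < 1 - y" "y \<noteq> 0"
      using that by (auto simp: field_simps abs_if)
    show ?thesis
      unfolding f_def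
      apply (rule derivative_eq_intros refl * numeral_neq_zero)+
      unfolding l r
      using * apply (simp add: divide_simps)
      apply (simp add: algebra_simps power2_eq_square power3_eq_cube)
      done
  qed
  have "2 * polylog 3 (1 / 2) + polylog 3 (-1) + (ln 2) ^ 3 / 6 + pi\<^sup>2 / 6 * ln 2 - (ln 2) ^ 3 / 2
      = polylog 3 (1::real)"
  proof (rule vanishing_derivative_limits_eq[of "1 / 2" 1 f])
    have "((\<lambda>y::real. 1 - 1 / y) \<longlongrightarrow> 0) (at_left 1)" "((\<lambda>y::real. 1 - y) \<longlongrightarrow> 0) (at_left 1)"
         "((\<lambda>y::real. (ln y) ^ 3 / 6) \<longlongrightarrow> 0) (at_left 1)"
         "((\<lambda>y::real. pi\<^sup>2 / 6 * ln y) \<longlongrightarrow> 0) (at_left 1)"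
         "((\<lambda>y::real. (ln y)\<^sup>2 * ln (1 - y) / 2) \<longlongrightarrow> 0) (at_left 1)"
      by real_asymp+
    then have "(f \<longlongrightarrow> polylog 3 1 + 0 + 0 - 0 - 0 + 0) (at_left 1)"
      unfolding f_def
      by (intro tendsto_add tendsto_diff polylog_at_left_1 polylog_tendsto_0) auto
    then show "(f \<longlongrightarrow> polylog 3 1) (at_left 1)"
      by simp
    have half: "((\<lambda>y::real. y) \<longlongrightarrow> 1 / 2) (at_right (1 / 2))"
      by (rule tendsto_ident_at)
    have h3: "isCont (polylog 3) (1 / 2 :: real)"
      by (rule isCont_polylog) auto
    have "filterlim (\<lambda>y::real. 1 - 1 / y) (at_right (- 1)) (at_right (1 / 2))"
      by real_asymp
    from filterlim_compose[OF polylog_at_right_minus_1 this]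
    have m1: "((\<lambda>y::real. polylog 3 (1 - 1 / y)) \<longlongrightarrow> polylog 3 (-1)) (at_right (1 / 2))"
      by simp
    have h4: "((\<lambda>y::real. polylog 3 (1 - y)) \<longlongrightarrow> polylog 3 (1 / 2)) (at_right (1 / 2))"
      using isCont_tendsto_compose[OF h3, of "\<lambda>y. 1 - y" "at_right (1 / 2)"]
      by (force intro!: tendsto_eq_intros)
    have "(f \<longlongrightarrow> polylog 3 (1 / 2) + polylog 3 (1 / 2) + polylog 3 (-1) - (ln (1 / 2)) ^ 3 / 6
        - pi\<^sup>2 / 6 * ln (1 / 2) + (ln (1 / 2))\<^sup>2 * ln (1 - 1 / 2) / 2) (at_right (1 / 2))"
      unfolding f_def
      by (intro tendsto_intros isCont_tendsto_compose[OF h3] m1 h4 half) auto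
    then show "(f \<longlongrightarrow> 2 * polylog 3 (1 / 2) + polylog 3 (-1) + (ln 2) ^ 3 / 6 + pi\<^sup>2 / 6 * ln 2
        - (ln 2) ^ 3 / 2) (at_right (1 / 2))"
      by (simp add: ln_div power2_eq_square power3_eq_cube)
  qed (use deriv in auto)
  then show ?thesis
    unfolding trilog_minus_1 by (simp add: field_simps)
qed

section \<open>The series of squared remainders\<close>

lemma ln_2_complex: "ln (2 :: complex) = of_real (ln 2)"
  using Ln_of_real[of 2] by simp

definition skew_harm_tail :: "nat \<Rightarrow> real" where
  "skew_harm_tail n = skew_harm n - ln 2"

lemma skew_harm_altdef: "skew_harm n = (\<Sum>k<n. (-1) ^ k / real (Suc k))"
  unfolding skew_harm_def
  by (rule sum.reindex_bij_witness[of _ Suc "\<lambda>k. k - 1"]) auto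

lemma skew_harm_tail_0: "skew_harm_tail 0 = - ln 2"
  by (simp add: skew_harm_tail_def skew_harm_altdef)

lemma skew_harm_tail_Suc: "skew_harm_tail (Suc n) = skew_harm_tail n + (-1) ^ n / real (Suc n)"
  by (simp add: skew_harm_tail_def skew_harm_altdef)

text \<open>An alternating sum with decreasing terms differs from its limit by at most the first
  omitted term.\<close>

lemma abs_skew_harm_tail_le: "\<bar>skew_harm_tail n\<bar> \<le> 1 / real (Suc n)"
proof -
  define a where "a n = 1 / real (Suc n)" for n
  have tail: "skew_harm_tail n = (\<Sum>k<n. (-1) ^ k * a k) - ln 2" for n
    by (simp add: skew_harm_tail_def skew_harm_altdef a_def)
  have "a \<longlonglongrightarrow> 0"
    unfolding a_def by real_asymp
  moreover have "0 \<le> a n" "a (Suc n) \<le> a n" for n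
    by (auto simp: a_def frac_le)
  moreover have "(\<Sum>k. (-1) ^ k * a k) = ln 2"
    using alternating_harmonic_series_sums by (simp add: a_def sums_iff)
  ultimately have le: "(\<Sum>k<2*n. (-1) ^ k * a k) \<le> ln 2" "ln 2 \<le> (\<Sum>k<2*n+1. (-1) ^ k * a k)" for n
    using summable_Leibniz'(2,4)[of a] by (metis, metis)
  show ?thesis
  proof (cases "even n")
    case True
    then obtain m where "n = 2 * m" by blast
    then show ?thesis
      using le(1)[of m] le(2)[of m] by (simp add: tail abs_if a_def)
  next
    case False
    then obtain m where "n = 2 * m + 1" by (blast elim: oddE)
    then show ?thesis
      using le(2)[of m] le(1)[of "Suc m"] by (simp add: tail abs_if a_def)
  qed
qed

lemma abs_skew_harm_tail_le_1: "\<bar>skew_harm_tail n\<bar> \<le> 1"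
proof -
  have "1 / real (Suc n) \<le> 1" by simp
  with abs_skew_harm_tail_le[of n] show ?thesis by linarith
qed

lemma skew_harm_tail_power_series:
  fixes x :: complex
  assumes "norm x < 1"
  shows "(1 - x) * (\<Sum>n. of_real (skew_harm_tail n) * x ^ n) = ln (1 + x) - ln 2"
proof -
  have "(1 - x) * (\<Sum>n. of_real (skew_harm_tail n) * x ^ n)
      = of_real (skew_harm_tail 0)
        + (\<Sum>n. (of_real (skew_harm_tail (Suc n)) - of_real (skew_harm_tail n)) * x ^ Suc n)"
    by (rule one_minus_times_power_series[OF _ assms, of _ 1])
      (simp add: abs_skew_harm_tail_le_1)
  also have "(\<lambda>n. (of_real (skew_harm_tail (Suc n)) - of_real (skew_harm_tail n)) * x ^ Suc n)
      = (\<lambda>n. - ((- x) ^ Suc n / of_nat (Suc n)))"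
    by (simp add: skew_harm_tail_Suc power_minus[of x] mult_ac del: of_nat_Suc)
  also have "(\<Sum>n. - ((- x) ^ Suc n / of_nat (Suc n))) = ln (1 + x)"
  proof -
    have "(\<lambda>n. - ((- x) ^ n / of_nat n)) sums ln (1 + x)"
      using Ln_series'[OF assms] by simp
    then have "(\<lambda>n. - ((- x) ^ Suc n / of_nat (Suc n))) sums ln (1 + x)"
      by (subst sums_Suc_iff) simp
    then show ?thesis
      by (rule sums_unique[symmetric])
  qed
  finally show ?thesis
    by (simp add: skew_harm_tail_0 ln_2_complex)
qed

lemma ln_half_complex:
  fixes z :: complex
  assumes "0 < Re z"
  shows "ln (z / 2) = ln z - ln 2"
  using Ln_divide_of_real[of 2 z] assms by (cases "z = 0") (auto simp: ln_2_complex)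

text \<open>By the preceding generating function at \<open>- x\<close>, the derivative of the left-hand side is
  \<open>(ln (1 - x) - ln 2) / (1 + x) = ln ((1 - x) / 2) / (1 + x)\<close>, which is that of
  \<open>- Li\<^sub>2((1 + x) / 2)\<close>.\<close>

lemma skew_harm_tail_alternating_primitive:
  fixes x :: complex
  assumes "norm x < 1"
  shows "primitive_series (\<lambda>n. (-1) ^ n * of_real (skew_harm_tail n)) x
    = polylog 2 (1 / 2) - polylog 2 ((1 + x) / 2)"
proof -
  define W where "W = primitive_series (\<lambda>n. (-1) ^ n * complex_of_real (skew_harm_tail n))"
  define f where "f y = W y + polylog 2 ((1 + y) / 2)" for y
  have "(f has_field_derivative 0) (at y)" if y: "norm y < 1" for y
  proof -
    have re: "Re y < 1" "- 1 < Re y"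
      using abs_Re_le_cmod[of y] y by auto
    have n: "norm ((1 + y) / 2) < 1" "(1 + y) / 2 \<noteq> 0"
      using norm_triangle_ineq[of 1 y] y re by (auto simp: norm_divide complex_eq_iff)
    have "(\<lambda>n. (-1) ^ n * of_real (skew_harm_tail n) * y ^ n)
        = (\<lambda>n. of_real (skew_harm_tail n) * (- y) ^ n)"
      by (simp add: power_minus[of y] fun_eq_iff)
    moreover have "(1 - (- y)) * (\<Sum>n. of_real (skew_harm_tail n) * (- y) ^ n) = ln (1 - y) - ln 2"
      using skew_harm_tail_power_series[of "- y"] y by simp
    moreover have ne: "1 + y \<noteq> 0" "2 + y * 2 \<noteq> 0"
      using re by (auto simp: complex_eq_iff)
    ultimately have "(\<Sum>n. (-1) ^ n * of_real (skew_harm_tail n) * y ^ n) = (ln (1 - y) - ln 2) / (1 + y)"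
      by (simp add: field_simps)
    moreover have "(W has_field_derivative (\<Sum>n. (-1) ^ n * of_real (skew_harm_tail n) * y ^ n)) (at y)"
      unfolding W_def using y
      by (rule has_field_derivative_primitive_series[rotated, where K = 1])
        (simp add: norm_mult norm_power abs_skew_harm_tail_le_1)
    ultimately have W: "(W has_field_derivative (ln (1 - y) - ln 2) / (1 + y)) (at y)"
      by simp
    have e: "1 - (1 + y) / 2 = (1 - y) / 2"
      by (simp add: field_simps)
    have l: "ln ((1 - y) / 2) = ln (1 - y) - ln 2"
      by (rule ln_half_complex) (use re in simp)
    show ?thesis
      unfolding f_def
      apply (rule derivative_eq_intros refl n W numeral_neq_zero)+
      unfolding e l using ne
      apply (simp add: divide_simps)
      apply (simp add: algebra_simps)
      done
  qed
  then have "\<exists>c. \<forall>y\<in>ball 0 1. f y = c"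
    by (intro has_field_derivative_zero_constant) (auto intro: has_field_derivative_at_within)
  then have "f x = f 0"
    using assms by force
  then show ?thesis
    by (simp add: f_def W_def algebra_simps)
qed

lemma dilog_half_complex: "polylog 2 (1 / 2 :: complex) = of_real (pi\<^sup>2 / 12 - (ln 2)\<^sup>2 / 2)"
  using polylog_of_real[of 2 "1 / 2"] by (simp add: dilog_half)

text \<open>The constant term \<open>(ln 2)\<^sup>2\<close> combines with \<open>2 Li\<^sub>2(1/2)\<close> to give \<open>\<pi>\<^sup>2 / 6\<close>.\<close>

lemma skew_harm_tail_square_power_series:
  fixes x :: complex
  assumes "norm x < 1"
  shows "(1 - x) * (\<Sum>n. of_real ((skew_harm_tail n)\<^sup>2) * x ^ n)
    = polylog 2 x - 2 * polylog 2 ((1 + x) / 2) + of_real pi ^ 2 / 6"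
proof -
  define a where "a n = complex_of_real (skew_harm_tail n)" for n
  have a1: "norm (a n) \<le> 1" for n
    by (simp add: a_def abs_skew_harm_tail_le_1)
  have suma: "summable (\<lambda>n. (-1) ^ n * a n * x ^ Suc n / of_nat (Suc n))"
  proof -
    have "norm ((-1) ^ n * a n * x / of_nat (Suc n)) \<le> 1" for n
    proof -
      have "norm (a n) * norm x / real (Suc n) \<le> 1 * 1 / 1"
        using a1[of n] assms by (intro frac_le mult_mono) auto
      then show ?thesis
        by (simp add: norm_mult norm_divide norm_power del: of_nat_Suc)
    qed
    then have "summable (\<lambda>n. ((-1) ^ n * a n * x / of_nat (Suc n)) * x ^ n)"
      by (rule summable_bounded_power_series[OF _ assms])
    then show ?thesis
      by (simp add: mult_ac del: of_nat_Suc)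
  qed
  have suml: "(\<lambda>n. x ^ Suc n / of_nat (Suc n) ^ 2) sums polylog 2 x"
    by (rule sums_polylog) (use assms in auto)
  have "(1 - x) * (\<Sum>n. a n ^ 2 * x ^ n) = a 0 ^ 2 + (\<Sum>n. (a (Suc n) ^ 2 - a n ^ 2) * x ^ Suc n)"
    by (rule one_minus_times_power_series[OF _ assms, of _ 1])
      (simp add: norm_power a1 power_le_one)
  also have "(\<lambda>n. (a (Suc n) ^ 2 - a n ^ 2) * x ^ Suc n)
      = (\<lambda>n. 2 * ((-1) ^ n * a n * x ^ Suc n / of_nat (Suc n)) + x ^ Suc n / of_nat (Suc n) ^ 2)"
  proof
    fix n
    have "a (Suc n) = a n + (-1) ^ n / of_nat (Suc n)"
      by (simp add: a_def skew_harm_tail_Suc del: of_nat_Suc)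
    moreover have "((-1) ^ n / of_nat (Suc n)) ^ 2 = (1 / of_nat (Suc n) ^ 2 :: complex)"
      by (simp add: power_divide del: of_nat_Suc flip: power_mult)
    ultimately have "a (Suc n) ^ 2 - a n ^ 2
        = 2 * ((-1) ^ n * a n / of_nat (Suc n)) + 1 / of_nat (Suc n) ^ 2"
      by (simp add: power2_sum mult_ac del: of_nat_Suc)
    then show "(a (Suc n) ^ 2 - a n ^ 2) * x ^ Suc n
      = 2 * ((-1) ^ n * a n * x ^ Suc n / of_nat (Suc n)) + x ^ Suc n / of_nat (Suc n) ^ 2"
      by (simp add: algebra_simps del: of_nat_Suc)
  qed
  also have "(\<Sum>n. 2 * ((-1) ^ n * a n * x ^ Suc n / of_nat (Suc n)) + x ^ Suc n / of_nat (Suc n) ^ 2)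
      = 2 * primitive_series (\<lambda>n. (-1) ^ n * a n) x + polylog 2 x"
    unfolding primitive_series_def
    by (rule sums_unique[symmetric], rule sums_add[OF _ suml], rule sums_mult, rule summable_sums, rule suma)
  also have "primitive_series (\<lambda>n. (-1) ^ n * a n) x = polylog 2 (1 / 2) - polylog 2 ((1 + x) / 2)"
    unfolding a_def by (rule skew_harm_tail_alternating_primitive[OF assms])
  finally show ?thesis
    by (simp add: a_def skew_harm_tail_0 dilog_half_complex algebra_simps)
qed

definition skew_harm_sum :: "complex \<Rightarrow> complex" where
  "skew_harm_sum = primitive_series (\<lambda>n. of_real ((skew_harm_tail n)\<^sup>2))"

lemma skew_harm_term_altdef:
  "skew_harm_term x n = of_real ((skew_harm_tail n)\<^sup>2) * x ^ Suc n / of_nat (Suc n)"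
  by (simp add: skew_harm_term_def skew_harm_tail_def ln_2_complex del: of_nat_Suc)

lemma summable_skew_harm_tail_square:
  "summable (\<lambda>n. norm (of_real ((skew_harm_tail n)\<^sup>2) :: 'a::real_normed_field) / real (Suc n))"
proof (rule summable_comparison_test')
  show "summable (\<lambda>n. inverse (real (Suc n) ^ 3))"
    using inverse_power_summable[of 3, where ?'a = real] by (subst summable_Suc_iff) simp
  show "norm (norm (of_real ((skew_harm_tail n)\<^sup>2) :: 'a) / real (Suc n)) \<le> inverse (real (Suc n) ^ 3)" for n
  proof -
    have "\<bar>skew_harm_tail n\<bar> ^ 2 \<le> (1 / real (Suc n)) ^ 2"
      by (rule power_mono[OF abs_skew_harm_tail_le]) simp
    then have "(skew_harm_tail n)\<^sup>2 / real (Suc n) \<le> (1 / real (Suc n)) ^ 2 / real (Suc n)"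
      by (intro divide_right_mono) auto
    also have "\<dots> = inverse (real (Suc n) ^ 3)"
      by (simp add: power_divide divide_simps power2_eq_square power3_eq_cube del: of_nat_Suc)
    finally show ?thesis
      by (simp del: of_nat_Suc of_real_power add: norm_power)
  qed
qed

lemma skew_harm_term_sums:
  assumes "norm x \<le> 1"
  shows "skew_harm_term x sums skew_harm_sum x"
  unfolding skew_harm_sum_def skew_harm_term_altdef [abs_def]
  by (rule sums_primitive_series[OF summable_skew_harm_tail_square assms])

lemma continuous_on_skew_harm_sum: "continuous_on (cball 0 1) skew_harm_sum"
  unfolding skew_harm_sum_def
  by (rule continuous_on_primitive_series[OF summable_skew_harm_tail_square])

lemma skew_harm_sum_has_field_derivative:
  assumes "norm x < 1"
  shows "(skew_harm_sum has_field_derivative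
    (polylog 2 x - 2 * polylog 2 ((1 + x) / 2) + of_real pi ^ 2 / 6) / (1 - x)) (at x)"
proof -
  have "(skew_harm_sum has_field_derivative (\<Sum>n. of_real ((skew_harm_tail n)\<^sup>2) * x ^ n)) (at x)"
    unfolding skew_harm_sum_def using assms
    by (rule has_field_derivative_primitive_series[rotated, where K = 1])
      (simp add: norm_power abs_skew_harm_tail_le_1 abs_square_le_1)
  moreover have "(\<Sum>n. of_real ((skew_harm_tail n)\<^sup>2) * x ^ n)
      = (polylog 2 x - 2 * polylog 2 ((1 + x) / 2) + of_real pi ^ 2 / 6) / (1 - x)"
    unfolding skew_harm_tail_square_power_series[OF assms, symmetric] using assms by auto
  ultimately show ?thesis
    by simp
qed

text \<open>The segment from \<open>0\<close> to \<open>x\<close> lies in the open disc except possibly for its endpoint, where a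
  primitive need only be continuous. So points on the unit circle need no limiting argument.\<close>

lemma skew_harm_rhs_eq:
  assumes x: "norm x \<le> 1" "x \<noteq> 1" "x \<noteq> -1"
  shows "skew_harm_sum x = skew_harm_rhs x"
proof -
  \<comment> \<open>everything on the right-hand side except the integral\<close>
  define R where "R z = 
     ln (1 - z) * (2 * polylog 2 ((1 + z) / 2) - of_real pi ^ 2 / 6)
     + 2 * ln (1 + z) * (ln (1 - z) ^ 2 - ln 2 ^ 2)
     + 2 * ln 2 * (polylog 2 ((1 + z) / 2) - polylog 2 (1 / 2))
     - 2 * ln 2 * ln (1 - z) ^ 2
     + 4 * ln (1 - z) * polylog 2 ((1 - z) / 2)
     - 4 * (polylog 3 ((1 - z) / 2) - polylog 3 (1 / 2))" for z :: complex
  define P where "P z = skew_harm_sum z - R z" for z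
  have re: "- 1 < Re z" "Re z < 1" if z: "norm z \<le> 1" "z \<noteq> 1" "z \<noteq> - 1" for z :: complex
  proof -
    have le: "(Re z)\<^sup>2 + (Im z)\<^sup>2 \<le> 1"
      using z(1) by (simp add: cmod_def)
    have "Re z \<noteq> 1 \<and> Re z \<noteq> - 1"
      using le z by (auto simp: complex_eq_iff)
    moreover have "\<bar>Re z\<bar> \<le> 1"
      using abs_Re_le_cmod[of z] z(1) by linarith
    ultimately show "- 1 < Re z" "Re z < 1"
      by auto
  qed
  have le1: "norm ((1 + z) / 2) \<le> 1" "norm ((1 - z) / 2) \<le> 1" if "norm z \<le> 1" for z :: complex
    using norm_triangle_ineq[of 1 z] norm_triangle_ineq4[of 1 z] that by (auto simp: norm_divide)
  have cont: "continuous_on (cball 0 1 - {1, -1}) P"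
  proof -
    have ne: "1 - z \<notin> \<real>\<^sub>\<le>\<^sub>0" "1 + z \<notin> \<real>\<^sub>\<le>\<^sub>0" if "z \<in> cball 0 1 - {1, -1}" for z :: complex
      using re[of z] that by (auto simp: complex_nonpos_Reals_iff)
    show ?thesis
      unfolding P_def R_def
      by (intro continuous_intros continuous_on_subset[OF continuous_on_skew_harm_sum])
        (use ne le1 in auto)
  qed
  have deriv: "(P has_field_derivative polylog 2 z / (1 - z)) (at z)" if z: "norm z < 1" for z
  proof -
    have rez: "- 1 < Re z" "Re z < 1"
      using abs_Re_le_cmod[of z] z by auto
    have *: "1 - z \<notin> \<real>\<^sub>\<le>\<^sub>0" "1 + z \<notin> \<real>\<^sub>\<le>\<^sub>0" "1 - z \<noteq> 0" "1 + z \<noteq> 0"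
        "2 + z * 2 \<noteq> 0" "2 - z * 2 \<noteq> 0" "(1 + z) / 2 \<noteq> 0" "(1 - z) / 2 \<noteq> 0"
      using rez by (auto simp: complex_nonpos_Reals_iff complex_eq_iff)
    have lt: "norm ((1 + z) / 2) < 1" "norm ((1 - z) / 2) < 1"
      using norm_triangle_ineq[of 1 z] norm_triangle_ineq4[of 1 z] z by (auto simp: norm_divide)
    have e: "1 - (1 + z) / 2 = (1 - z) / 2" "1 - (1 - z) / 2 = (1 + z) / 2"
      by (auto simp: field_simps)
    have l: "ln ((1 - z) / 2) = ln (1 - z) - ln 2" "ln ((1 + z) / 2) = ln (1 + z) - ln 2"
      by (rule ln_half_complex, use rez in simp)+
    \<comment> \<open>in the derivative of \<open>R\<close> all products of two logarithms cancel, and so do the two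
      occurrences of \<open>Li\<^sub>2((1 - z) / 2)\<close>\<close>
    show ?thesis
      unfolding P_def R_def
      apply (rule derivative_eq_intros refl * lt numeral_neq_zero skew_harm_sum_has_field_derivative[OF z])+
      unfolding e unfolding l
      using * apply (simp add: divide_simps)
      apply (simp add: algebra_simps power2_eq_square)
      done
  qed
  have "((\<lambda>t. polylog 2 (of_real t * x) / (1 - of_real t * x) * x) has_integral
      P (of_real 1 * x) - P (of_real 0 * x)) {0..1}"
  proof (rule fundamental_theorem_of_calculus_interior)
    have "of_real t * x \<in> cball 0 1 - {1, -1}" if "0 \<le> t" "t \<le> 1" for t :: real
    proof -
      have "norm (of_real t * x) \<le> 1"
        using that x(1) by (simp add: norm_mult mult_le_one)
      moreover have "of_real t * x \<noteq> 1 \<and> of_real t * x \<noteq> - 1"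
      proof (rule ccontr)
        assume *: "\<not> ?thesis"
        then have "norm (of_real t * x) = 1"
          by auto
        then have "t * norm x = 1"
          using that by (simp add: norm_mult)
        then have "t = 1"
          using that x(1) mult_left_le[of "norm x" t] by linarith
        with * x show False by auto
      qed
      ultimately show ?thesis by simp
    qed
    then show "continuous_on {0..1} (\<lambda>t. P (of_real t * x))"
      by (intro continuous_on_compose2[OF cont] continuous_intros) auto
    show "((\<lambda>t. P (of_real t * x)) has_vector_derivative
        polylog 2 (of_real t * x) / (1 - of_real t * x) * x) (at t)" if "t \<in> {0<..<1}" for t
    proof (rule has_vector_derivative_real_field[where f = "\<lambda>w. P (w * x)"])
      have "norm (of_real t * x) < 1"
      proof -
        have "t * norm x \<le> t"
          using that x(1) by (simp add: mult_left_le)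
        moreover have "norm (of_real t * x) = t * norm x" "t < 1"
          using that by (auto simp: norm_mult)
        ultimately show ?thesis
          by linarith
      qed
      then show "((\<lambda>w. P (w * x)) has_field_derivative
          polylog 2 (of_real t * x) / (1 - of_real t * x) * x) (at (of_real t))"
        by (intro DERIV_chain'[OF _ deriv]) (auto intro!: derivative_eq_intros)
    qed
  qed simp
  moreover have "P 0 = 0"
    by (simp add: P_def R_def skew_harm_sum_def)
  ultimately have "((\<lambda>t. polylog 2 t / (1 - t)) has_contour_integral P x) (linepath 0 x)"
    unfolding has_contour_integral_linepath by (simp add: linepath_def scaleR_conv_of_real)
  then have "contour_integral (linepath 0 x) (\<lambda>t. polylog 2 t / (1 - t)) = P x"
    by (rule contour_integral_unique)
  then show ?thesis
    by (simp add: skew_harm_rhs_def Li_eq_polylog P_def R_def)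
qed

section \<open>The values at the two singular points\<close>

definition real_skew_harm_sum :: "real \<Rightarrow> real" where
  "real_skew_harm_sum = primitive_series (\<lambda>n. (skew_harm_tail n)\<^sup>2)"

lemma skew_harm_sum_of_real:
  fixes x :: real
  assumes "\<bar>x\<bar> \<le> 1"
  shows "skew_harm_sum (of_real x) = of_real (real_skew_harm_sum x)"
proof (rule sums_unique2)
  show "(\<lambda>n. of_real ((skew_harm_tail n)\<^sup>2 * x ^ Suc n / of_nat (Suc n)) :: complex)
      sums of_real (real_skew_harm_sum x)"
    unfolding real_skew_harm_sum_def sums_of_real_iff
    using sums_primitive_series[OF summable_skew_harm_tail_square[where ?'a = real], of x] assms
    by simp
  show "(\<lambda>n. of_real ((skew_harm_tail n)\<^sup>2 * x ^ Suc n / of_nat (Suc n)) :: complex)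
      sums skew_harm_sum (of_real x)"
    using skew_harm_term_sums[of "of_real x"] assms
    by (simp add: skew_harm_term_altdef [abs_def] del: of_nat_Suc)
qed

lemma continuous_on_real_skew_harm_sum: "continuous_on {-1..1} real_skew_harm_sum"
  unfolding real_skew_harm_sum_def
  using continuous_on_primitive_series[OF summable_skew_harm_tail_square[where ?'a = real]]
  by (simp add: cball_eq_atLeastAtMost)

lemma real_skew_harm_sum_has_real_derivative:
  assumes "\<bar>x\<bar> < 1"
  shows "(real_skew_harm_sum has_real_derivative
    (polylog 2 x - 2 * polylog 2 ((1 + x) / 2) + pi\<^sup>2 / 6) / (1 - x)) (at x)"
proof -
  define s where "s = (\<Sum>n. (skew_harm_tail n)\<^sup>2 * x ^ n)"
  have bound: "norm ((skew_harm_tail n)\<^sup>2) \<le> 1" for n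
    by (simp add: abs_skew_harm_tail_le_1 abs_square_le_1)
  have deriv: "(real_skew_harm_sum has_real_derivative s) (at x)"
    unfolding real_skew_harm_sum_def s_def using assms
    by (intro has_field_derivative_primitive_series[OF bound]) simp
  have "(1 - x) * s = polylog 2 x - 2 * polylog 2 ((1 + x) / 2) + pi\<^sup>2 / 6"
  proof -
    have "complex_of_real s = (\<Sum>n. of_real ((skew_harm_tail n)\<^sup>2) * of_real x ^ n)"
      unfolding s_def
      using suminf_of_real[OF summable_bounded_power_series[OF bound], of x, where ?'a = complex] assms
      by simp
    moreover have "polylog 2 ((1 + of_real x) / 2 :: complex) = of_real (polylog 2 ((1 + x) / 2))"
      using polylog_of_real[of 2 "(1 + x) / 2"] assms by simp
    moreover have "polylog 2 (of_real x :: complex) = of_real (polylog 2 x)"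
      using polylog_of_real[of 2 x] assms by simp
    ultimately have "complex_of_real ((1 - x) * s)
        = of_real (polylog 2 x - 2 * polylog 2 ((1 + x) / 2) + pi\<^sup>2 / 6)"
      using skew_harm_tail_square_power_series[of "of_real x"] assms by simp
    then show ?thesis
      by (simp only: of_real_eq_iff)
  qed
  then have "s = (polylog 2 x - 2 * polylog 2 ((1 + x) / 2) + pi\<^sup>2 / 6) / (1 - x)"
    using assms by (auto simp: eq_divide_eq mult.commute)
  with deriv show ?thesis
    by simp
qed

text \<open>The coefficients are chosen so that the reflection formula absorbs the product of
  logarithms in the derivative. What remains has the form of the summands of the derivative
  of the series.\<close>

definition log_trilog :: "real \<Rightarrow> real" where
  "log_trilog u = ln u * polylog 2 u - 2 * polylog 3 u"

lemma log_trilog_has_real_derivative [derivative_intros]: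
  assumes "(f has_field_derivative D) (at x within S)" "0 < f x" "f x < 1"
  shows "((\<lambda>x. log_trilog (f x)) has_field_derivative
    (polylog 2 (1 - f x) - pi\<^sup>2 / 6) / f x * D) (at x within S)"
proof -
  have *: "norm (f x) < 1" "f x \<noteq> 0"
    using assms by auto
  have r: "polylog 2 (1 - f x) = pi\<^sup>2 / 6 - ln (f x) * ln (1 - f x) - polylog 2 (f x)"
    using dilog_reflection[of "f x"] assms by simp
  show ?thesis
    unfolding log_trilog_def r
    by (rule derivative_eq_intros refl assms * numeral_neq_zero)+
      (use * in \<open>simp add: field_simps\<close>)
qed

lemma log_trilog_half: "log_trilog (1 / 2) = pi\<^sup>2 / 12 * ln 2 + (ln 2) ^ 3 / 6 - 7 / 4 * polylog 3 1"
  by (simp add: log_trilog_def dilog_half trilog_half ln_div power2_eq_square power3_eq_cube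
      algebra_simps)

text \<open>The logarithm is compensated by the simple zero of the dilogarithm at 0.\<close>

lemma log_trilog_at_right_0: "(log_trilog \<longlongrightarrow> 0) (at_right 0)"
proof -
  obtain D where "(polylog 2 has_real_derivative D) (at 0)"
    using has_field_derivative_primitive_series[of "\<lambda>n. 1 / of_nat (Suc n) ^ 1" 1 "0::real"]
      norm_inverse_power_le_1[of _ 1, where ?'a = real] polylog_Suc[of 1, where ?'a = real]
    by (auto simp: numeral_2_eq_2 simp del: of_nat_Suc)
  then have "((\<lambda>y. polylog 2 y / y) \<longlongrightarrow> D) (at 0)"
    by (simp add: has_field_derivative_iff)
  then have "((\<lambda>y. polylog 2 y / y) \<longlongrightarrow> D) (at_right 0)"
    by (rule filterlim_mono) (auto intro: at_le)
  moreover have "((\<lambda>y::real. y * ln y) \<longlongrightarrow> 0) (at_right 0)"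
    by real_asymp
  ultimately have "((\<lambda>y. (y * ln y) * (polylog 2 y / y)) \<longlongrightarrow> 0 * D) (at_right 0)"
    by (intro tendsto_mult)
  moreover have "\<forall>\<^sub>F y in at_right (0::real). (y * ln y) * (polylog 2 y / y) = ln y * polylog 2 y"
    using eventually_at_right_less[of 0] by eventually_elim simp
  ultimately have "((\<lambda>y. ln y * polylog 2 y) \<longlongrightarrow> 0 * D) (at_right 0)"
    by (rule Lim_transform_eventually)
  moreover have "((\<lambda>y::real. 2 * polylog 3 y) \<longlongrightarrow> 2 * 0) (at_right 0)"
    by (intro tendsto_mult_left polylog_tendsto_0) (auto intro: tendsto_ident_at)
  ultimately have "(log_trilog \<longlongrightarrow> 0 * D - 2 * 0) (at_right 0)"
    unfolding log_trilog_def by (rule tendsto_diff)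
  then show ?thesis by simp
qed

lemma log_trilog_at_left_1: "(log_trilog \<longlongrightarrow> - 2 * polylog 3 1) (at_left 1)"
proof -
  have "(ln \<longlongrightarrow> 0) (at_left (1::real))"
    by real_asymp
  then have "(log_trilog \<longlongrightarrow> 0 * polylog 2 1 - 2 * polylog 3 1) (at_left 1)"
    unfolding log_trilog_def by (intro tendsto_intros polylog_at_left_1) auto
  then show ?thesis by simp
qed

lemma log_trilog_tendsto_half:
  assumes "(f \<longlongrightarrow> 1 / 2) F"
  shows "((\<lambda>x. log_trilog (f x)) \<longlongrightarrow> log_trilog (1 / 2)) F"
proof -
  have "(log_trilog has_real_derivative (polylog 2 (1 - 1 / 2) - pi\<^sup>2 / 6) / (1 / 2) * 1) (at (1 / 2))"
    by (rule log_trilog_has_real_derivative[where f = "\<lambda>x. x"]) auto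
  then have "isCont log_trilog (1 / 2)"
    by (rule DERIV_isCont)
  then show ?thesis
    using assms by (rule isCont_tendsto_compose)
qed

lemma real_skew_harm_sum_tendsto_0: "(real_skew_harm_sum \<longlongrightarrow> 0) (at 0 within S)"
proof -
  have "isCont real_skew_harm_sum 0"
    using continuous_on_real_skew_harm_sum by (rule continuous_on_interior) simp
  then have "(real_skew_harm_sum \<longlongrightarrow> real_skew_harm_sum 0) (at 0 within S)"
    by (meson continuous_at_imp_continuous_at_within continuous_within)
  then show ?thesis
    by (simp add: real_skew_harm_sum_def)
qed

text \<open>On \<open>(0, 1)\<close> both \<open>(1 - x) / 2\<close> and \<open>1 - x\<close> lie in \<open>(0, 1)\<close>, and both tend to 0 at the end
  \<open>x = 1\<close>, where \<open>log_trilog\<close> vanishes.\<close>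

lemma real_skew_harm_sum_1:
  "real_skew_harm_sum 1 = 3 / 2 * polylog 3 1 - pi\<^sup>2 / 6 * ln 2 - (ln 2) ^ 3 / 3"
proof -
  define f where "f x = real_skew_harm_sum x - 2 * log_trilog ((1 - x) / 2) + log_trilog (1 - x)" for x
  have "0 - 2 * log_trilog (1 / 2) + - 2 * polylog 3 1 = real_skew_harm_sum 1 - 2 * 0 + 0"
  proof (rule vanishing_derivative_limits_eq[of 0 1 f])
    show "(f has_real_derivative 0) (at x)" if "0 < x" "x < 1" for x
    proof -
      have *: "0 < (1 - x) / 2" "(1 - x) / 2 < 1" "0 < 1 - x" "1 - x < 1" "\<bar>x\<bar> < 1"
        using that by auto
      have e: "1 - (1 - x) / 2 = (1 + x) / 2" "1 - (1 - x) = x"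
        by (auto simp: field_simps)
      show ?thesis
        unfolding f_def
        apply (rule derivative_eq_intros refl * numeral_neq_zero
            real_skew_harm_sum_has_real_derivative)+
        unfolding e
        using * apply (simp add: divide_simps)
        apply (simp add: algebra_simps)
        done
    qed
    have "filterlim (\<lambda>x::real. 1 - x) (at_left 1) (at_right 0)"
        "((\<lambda>x::real. (1 - x) / 2) \<longlongrightarrow> 1 / 2) (at_right 0)"
        "filterlim (\<lambda>x::real. 1 - x) (at_right 0) (at_left 1)"
        "filterlim (\<lambda>x::real. (1 - x) / 2) (at_right 0) (at_left 1)"
      by real_asymp+
    note lims = this
    show "(f \<longlongrightarrow> 0 - 2 * log_trilog (1 / 2) + - 2 * polylog 3 1) (at_right 0)"
      unfolding f_def
      by (intro tendsto_intros real_skew_harm_sum_tendsto_0 log_trilog_tendsto_half lims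
          filterlim_compose[OF log_trilog_at_left_1])
    have "(real_skew_harm_sum \<longlongrightarrow> real_skew_harm_sum 1) (at_left 1)"
      using continuous_on_real_skew_harm_sum by (rule continuous_on_Icc_at_leftD) simp
    then show "(f \<longlongrightarrow> real_skew_harm_sum 1 - 2 * 0 + 0) (at_left 1)"
      unfolding f_def
      by (intro tendsto_intros lims filterlim_compose[OF log_trilog_at_right_0])
  qed simp
  then show ?thesis
    by (simp add: log_trilog_half algebra_simps)
qed

text \<open>For negative \<open>x\<close> the argument \<open>1 - x\<close> exceeds 1, so it is replaced by its inverse; Landen's
  formula relates \<open>Li\<^sub>2(x)\<close> to \<open>Li\<^sub>2(1 - 1 / (1 - x))\<close> at the cost of a cubic logarithm, and the
  linear logarithm balances the constants \<open>\<pi>\<^sup>2 / 6\<close>, which no longer cancel.\<close>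

lemma real_skew_harm_sum_minus_1:
  "real_skew_harm_sum (- 1) = pi\<^sup>2 / 12 * ln 2 - 3 / 4 * polylog 3 1 - (ln 2) ^ 3 / 3"
proof -
  define f where "f x = real_skew_harm_sum x - 2 * log_trilog ((1 - x) / 2) + log_trilog (1 / (1 - x))
    - pi\<^sup>2 / 3 * ln (1 - x) - (ln (1 - x)) ^ 3 / 6" for x
  have "real_skew_harm_sum (- 1) - 2 * (- 2 * polylog 3 1) + log_trilog (1 / 2)
      - pi\<^sup>2 / 3 * ln 2 - (ln 2) ^ 3 / 6
    = 0 - 2 * log_trilog (1 / 2) + (- 2 * polylog 3 1) - pi\<^sup>2 / 3 * 0 - 0"
  proof (rule vanishing_derivative_limits_eq[of "- 1" 0 f])
    show "(f has_real_derivative 0) (at x)" if "- 1 < x" "x < 0" for x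
    proof -
      have *: "0 < (1 - x) / 2" "(1 - x) / 2 < 1" "0 < 1 / (1 - x)" "1 / (1 - x) < 1" "\<bar>x\<bar> < 1"
          "0 < 1 - x" "1 - x \<noteq> 0"
        using that by (auto simp: field_simps)
      have e: "1 - (1 - x) / 2 = (1 + x) / 2"
        by (auto simp: field_simps)
      have l: "polylog 2 (1 - 1 / (1 - x)) = - (ln (1 - x))\<^sup>2 / 2 - polylog 2 x"
        using dilog_landen[of "1 / (1 - x)"] * that by (simp add: ln_div)
      show ?thesis
        unfolding f_def
        apply (rule derivative_eq_intros refl * numeral_neq_zero
            real_skew_harm_sum_has_real_derivative)+
        unfolding e l
        using * apply (simp add: divide_simps)
        apply (simp add: algebra_simps power2_eq_square)
        done
    qed
    have lims: "filterlim (\<lambda>x::real. (1 - x) / 2) (at_left 1) (at_right (- 1))"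
        "((\<lambda>x::real. 1 / (1 - x)) \<longlongrightarrow> 1 / 2) (at_right (- 1))"
        "((\<lambda>x::real. ln (1 - x)) \<longlongrightarrow> ln 2) (at_right (- 1))"
        "((\<lambda>x::real. (ln (1 - x)) ^ 3 / 6) \<longlongrightarrow> (ln 2) ^ 3 / 6) (at_right (- 1))"
        "((\<lambda>x::real. (1 - x) / 2) \<longlongrightarrow> 1 / 2) (at_left 0)"
        "filterlim (\<lambda>x::real. 1 / (1 - x)) (at_left 1) (at_left 0)"
        "((\<lambda>x::real. ln (1 - x)) \<longlongrightarrow> 0) (at_left 0)"
        "((\<lambda>x::real. (ln (1 - x)) ^ 3 / 6) \<longlongrightarrow> 0) (at_left 0)"
      by real_asymp+
    have "(real_skew_harm_sum \<longlongrightarrow> real_skew_harm_sum (- 1)) (at_right (- 1))"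
      using continuous_on_real_skew_harm_sum by (rule continuous_on_Icc_at_rightD) simp
    then show "(f \<longlongrightarrow> real_skew_harm_sum (- 1) - 2 * (- 2 * polylog 3 1) + log_trilog (1 / 2)
        - pi\<^sup>2 / 3 * ln 2 - (ln 2) ^ 3 / 6) (at_right (- 1))"
      unfolding f_def
      by (intro tendsto_add tendsto_diff tendsto_mult_left log_trilog_tendsto_half lims
          filterlim_compose[OF log_trilog_at_left_1])
    show "(f \<longlongrightarrow> 0 - 2 * log_trilog (1 / 2) + (- 2 * polylog 3 1) - pi\<^sup>2 / 3 * 0 - 0) (at_left 0)"
      unfolding f_def
      by (intro tendsto_add tendsto_diff tendsto_mult_left log_trilog_tendsto_half lims
          real_skew_harm_sum_tendsto_0 filterlim_compose[OF log_trilog_at_left_1])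
  qed simp
  then show ?thesis
    by (simp add: log_trilog_half algebra_simps)
qed

lemma zeta_3_eq_trilog: "zeta 3 = of_real (polylog 3 1)"
proof -
  have "of_nat (Suc n) powr 3 = (of_nat (Suc n) ^ 3 :: complex)" for n
    using powr_nat'[of "of_nat (Suc n)" 3] by (simp del: of_nat_Suc)
  then have "zeta 3 = polylog 3 1"
    by (simp add: zeta_def polylog_def del: of_nat_Suc)
  also have "\<dots> = of_real (polylog 3 1)"
    using polylog_of_real[of 3 1] by simp
  finally show ?thesis .
qed

theorem proposition8:
  shows "(\<forall>x::complex. norm x \<le> 1 \<and> x \<noteq> 1 \<and> x \<noteq> -1 \<longrightarrow>
            skew_harm_term x sums skew_harm_rhs x)
       \<and> (\<forall>x\<in>{1, -1}. \<exists>S. skew_harm_term x sums S \<and>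
            (skew_harm_rhs \<longlongrightarrow> S) (at x within cball 0 1))
       \<and> (\<lambda>n. (of_real (skew_harm n) - ln 2)\<^sup>2 * (1 / of_nat (n + 1))) sums
            (3 / 2 * zeta 3 - of_real pi ^ 2 / 6 * ln 2 - 1 / 3 * ln 2 ^ 3)
       \<and> (\<lambda>n. (of_real (skew_harm n) - ln 2)\<^sup>2 * ((-1) ^ (n + 1) / of_nat (n + 1))) sums
            (of_real pi ^ 2 / 12 * ln 2 - 3 / 4 * zeta 3 - 1 / 3 * ln 2 ^ 3)"
proof (intro conjI allI impI ballI)
  fix x :: complex
  assume "norm x \<le> 1 \<and> x \<noteq> 1 \<and> x \<noteq> -1"
  then show "skew_harm_term x sums skew_harm_rhs x"
    using skew_harm_term_sums[of x] skew_harm_rhs_eq[of x] by simp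
next
  fix x :: complex
  assume x: "x \<in> {1, -1}"
  have "(skew_harm_sum \<longlongrightarrow> skew_harm_sum x) (at x within cball 0 1)"
    using continuous_on_skew_harm_sum x by (auto simp: continuous_on_def)
  moreover have "\<forall>\<^sub>F y in at x within cball 0 1. skew_harm_sum y = skew_harm_rhs y"
    unfolding eventually_at
    \<comment> \<open>the other exceptional point is at distance 2\<close>
    by (rule exI[of _ 1]) (use x in \<open>auto intro!: skew_harm_rhs_eq simp: dist_norm\<close>)
  ultimately have "(skew_harm_rhs \<longlongrightarrow> skew_harm_sum x) (at x within cball 0 1)"
    by (rule Lim_transform_eventually)
  moreover have "skew_harm_term x sums skew_harm_sum x"
    by (rule skew_harm_term_sums) (use x in auto)
  ultimately show "\<exists>S. skew_harm_term x sums S \<and> (skew_harm_rhs \<longlongrightarrow> S) (at x within cball 0 1)"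
    by blast
next
  have "skew_harm_term 1 sums of_real (real_skew_harm_sum 1)"
    using skew_harm_term_sums[of 1] skew_harm_sum_of_real[of 1] by simp
  then show "(\<lambda>n. (of_real (skew_harm n) - ln 2)\<^sup>2 * (1 / of_nat (n + 1))) sums
      (3 / 2 * zeta 3 - of_real pi ^ 2 / 6 * ln 2 - 1 / 3 * ln 2 ^ 3)"
    by (simp add: skew_harm_term_def [abs_def] real_skew_harm_sum_1 zeta_3_eq_trilog ln_2_complex)
next
  have "skew_harm_term (-1) sums of_real (real_skew_harm_sum (-1))"
    using skew_harm_term_sums[of "-1"] skew_harm_sum_of_real[of "-1"] by simp
  then show "(\<lambda>n. (of_real (skew_harm n) - ln 2)\<^sup>2 * ((-1) ^ (n + 1) / of_nat (n + 1))) sums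
      (of_real pi ^ 2 / 12 * ln 2 - 3 / 4 * zeta 3 - 1 / 3 * ln 2 ^ 3)"
    by (simp add: skew_harm_term_def [abs_def] real_skew_harm_sum_minus_1 zeta_3_eq_trilog ln_2_complex)
qed

end
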